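(* For every $d\ge 1$ there exists a $1$-parallel set in $\mathbb{R}^d$, i.e. a set of the form $A_1=A+B_2^d$ with $A\subset\mathbb{R}^d$ Borel, such that $$\gamma_d^+(\partial A_1)\;\geq\;0.28\cdot d^{1/4}.$$
   Context: For sets $A,B\subset\mathbb{R}^d$, the Minkowski sum is $A+B=\{a+b:\ a\in A,\ b\in B\}$. $B_2^d$ denotes the closed unit Euclidean ball in $\mathbb{R}^d$. For $r>0$, a set is called $r$-parallel if it is of the form $A_r=A+rB_2^d$ for some Borel set $A\subset\mathbb{R}^d$. $\gamma_d$ denotes the standard Gaussian measure on $\mathbb{R}^d$, i.e. the measure with density $(2\pi)^{-d/2}e^{-|x|^2/2}$, where $|x|$ is the Euclidean norm. The upper Gaussian surface area of a measurable set $E\subset\mathbb{R}^d$ is $$\gamma_d^+(\partial E)=\limsup_{\varepsilon\to0^+}\frac{\gamma_d(E+\varepsilon B_2^d)-\gamma_d(E)}{\varepsilon}.$$ *)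

theory Defs
  imports "HOL-Analysis.Analysis"
begin

(* The density is taken over lebesgue rather than lborel because E + cball 0 r is always
   Lebesgue measurable but need not be Borel, even for Borel E; measure returns 0 on
   sets outside the sigma-algebra. *)
definition std_gaussian :: "'a::euclidean_space measure" where
  "std_gaussian = density lebesgue
     (\<lambda>x. ennreal ((2 * pi) powr (- real DIM('a) / 2) * exp (- (norm x)\<^sup>2 / 2)))"

(* A + B on sets is the Minkowski sum of HOL-Library.Set_Algebras. *)
definition ball_thickening :: "real \<Rightarrow> 'a::euclidean_space set \<Rightarrow> 'a set" where
  "ball_thickening r A = A + (\<lambda>x. r *\<^sub>R x) ` cball 0 1"

definition is_parallel_set :: "real \<Rightarrow> 'a::euclidean_space set \<Rightarrow> bool" where
  "is_parallel_set r S \<longleftrightarrow> 0 < r \<and> (\<exists>A \<in> sets borel. S = ball_thickening r A)"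

(* Extended-real valued, as the limsup may be infinite. *)
definition upper_gaussian_surface_area :: "'a::euclidean_space set \<Rightarrow> ereal" where
  "upper_gaussian_surface_area E =
     Limsup (at_right 0)
       (\<lambda>\<epsilon>. ereal ((measure std_gaussian (ball_thickening \<epsilon> E) - measure std_gaussian E) / \<epsilon>))"

end

theory Submission
  imports Defs "HOL-Probability.Probability"
begin

text \<open>
  Write \<open>\<gamma>\<close> for the Gaussian measure, \<open>d\<close> for the dimension and \<open>A\<^sub>r\<close> for the thickening of \<open>A\<close>
  by \<open>r\<close>. The theorem holds with any constant below \<open>d / e\<close> in place of \<open>0.28 d powr (1/4)\<close>, because
  of the following heuristic. Centre unit balls at a Poisson process of intensity one point per unit
  ball volume. A given point of space is then left uncovered with probability \<open>exp (-1)\<close>, whereas it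
  is left uncovered by the balls of radius \<open>s > 1\<close> with probability \<open>exp (-(s ^ d))\<close>. Enlarging the
  radius from \<open>1\<close> to \<open>s\<close> therefore increases the expected measure of the union by
  \<open>exp (-1) - exp (-(s ^ d))\<close>, and the derivative of this expression at \<open>s = 1\<close> is \<open>d / e\<close>.

  Two devices make this rigorous. The Poisson process is replaced by \<open>m ^ d\<close> independent
  uniform points in the ball of radius \<open>m\<close>: there are as many points as unit ball volumes, so each
  ball of radius \<open>t\<close> well inside has probability \<open>t ^ d / m ^ d\<close>, and as \<open>m\<close> grows the uncovered
  probabilities tend to those above while \<open>\<gamma>\<close> of the exceptional region near and beyond the boundary
  vanishes (\<open>exists_large_shell\<close>, \<open>exists_fast_growing_thickening\<close>). This gives a single finite set
  \<open>A\<close> for which \<open>\<gamma> A\<^sub>s - \<gamma> A\<^sub>1\<close> is large.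

  Exchanging the expectation with the limit that defines the surface area is avoided by allowing the
  radius to vary: since \<open>r \<mapsto> \<gamma> A\<^sub>r\<close> is continuous, its upper right derivative is at some
  \<open>t\<close> in \<open>[1, s)\<close> at least its mean slope (\<open>upper_right_derivative_mean_value\<close>). That derivative is the
  upper surface area of \<open>A\<^sub>t\<close>, and \<open>A\<^sub>t\<close> is 1-parallel, being the thickening of \<open>A\<close> by \<open>t - 1\<close>
  thickened by \<open>1\<close>.
\<close>

section \<open>The standard Gaussian measure\<close>

lemma space_std_gaussian [simp]: "space std_gaussian = UNIV"
  by (simp add: std_gaussian_def)

lemma sets_std_gaussian [simp, measurable_cong]: "sets std_gaussian = sets lebesgue"
  by (simp add: std_gaussian_def)

lemma gaussian_density_borel [measurable]:
  "(\<lambda>x::'a::euclidean_space.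
      ennreal ((2 * pi) powr (- real DIM('a) / 2) * exp (- (norm x)\<^sup>2 / 2)))
    \<in> borel_measurable borel"
  by measurable

lemma gaussian_density_eq_prod:
  fixes x :: "'a::euclidean_space"
  shows "(2 * pi) powr (- real DIM('a) / 2) * exp (- (norm x)\<^sup>2 / 2)
    = (\<Prod>b\<in>Basis. std_normal_density (x \<bullet> b))"
proof -
  have 1: "(\<Prod>b\<in>(Basis::'a set). 1 / sqrt (2 * pi)) = (2 * pi) powr (- real DIM('a) / 2)"
    by (simp add: powr_half_sqrt [symmetric] powr_powr powr_minus powr_realpow [symmetric]
        field_simps)
  have 2: "(\<Prod>b\<in>Basis. exp (- (x \<bullet> b)\<^sup>2 / 2)) = exp (- (norm x)\<^sup>2 / 2)"
    unfolding power2_norm_eq_inner euclidean_inner [of x x]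
    by (simp add: exp_sum [symmetric] sum_negf sum_divide_distrib [symmetric] power2_eq_square)
  show ?thesis
    by (simp only: std_normal_density_def prod.distrib 1 2)
qed

lemma prob_space_std_gaussian: "prob_space (std_gaussian :: 'a::euclidean_space measure)"
proof
  have 1: "(\<integral>\<^sup>+t. ennreal (std_normal_density t) \<partial>lborel) = 1"
    by (subst nn_integral_eq_integral) (auto simp: integrable_normal_density)
  have "emeasure (std_gaussian :: 'a measure) (space std_gaussian)
    = (\<integral>\<^sup>+x. ennreal ((2 * pi) powr (- real DIM('a) / 2) * exp (- (norm (x::'a))\<^sup>2 / 2)) \<partial>lebesgue)"
    by (simp add: std_gaussian_def emeasure_density measurable_completion)
  also have "\<dots> = (\<integral>\<^sup>+x. (\<Prod>b\<in>Basis. ennreal (std_normal_density ((x::'a) \<bullet> b))) \<partial>lborel)"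
    unfolding nn_integral_completion gaussian_density_eq_prod by (simp add: prod_ennreal)
  also have "\<dots> = 1"
    by (subst nn_integral_lborel_prod) (auto simp: 1)
  finally show "emeasure (std_gaussian :: 'a measure) (space std_gaussian) = 1" .
qed

text \<open>The Gaussian density is bounded by 1. This crude comparison suffices to transfer continuity in
  the radius from Lebesgue measure to Gaussian measure.\<close>

lemma std_gaussian_le_lebesgue:
  fixes S :: "'a::euclidean_space set"
  assumes "S \<in> sets lebesgue"
  shows "emeasure std_gaussian S \<le> emeasure lebesgue S"
proof -
  have "(2 * pi) powr (- real DIM('a) / 2) \<le> (2 * pi) powr 0"
    using pi_ge_two by (intro powr_mono) auto
  then have "(2 * pi) powr (- real DIM('a) / 2) * exp (- (norm (x::'a))\<^sup>2 / 2) \<le> 1" for x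
    by (intro mult_le_one) auto
  then have le_1: "ennreal ((2 * pi) powr (- real DIM('a) / 2) * exp (- (norm (x::'a))\<^sup>2 / 2)) \<le> 1" for x
    unfolding ennreal_1 [symmetric] by (intro ennreal_leI)
  have "emeasure std_gaussian S = (\<integral>\<^sup>+x. ennreal ((2 * pi) powr (- real DIM('a) / 2) *
      exp (- (norm x)\<^sup>2 / 2)) * indicator S x \<partial>lebesgue)"
    unfolding std_gaussian_def
    by (intro emeasure_density assms measurable_completion) simp
  also have "\<dots> \<le> (\<integral>\<^sup>+x. 1 * indicator S x \<partial>lebesgue)"
    by (intro nn_integral_mono mult_right_mono le_1) auto
  also have "\<dots> = emeasure lebesgue S"
    using assms by (simp only: mult_1 nn_integral_indicator)
  finally show ?thesis .
qed

section \<open>Thickenings\<close>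

lemma ball_thickening_eq_UN:
  fixes A :: "'a::euclidean_space set"
  assumes "0 \<le> r"
  shows "ball_thickening r A = (\<Union>a\<in>A. cball a r)"
proof -
  have "(\<lambda>x. r *\<^sub>R x) ` cball 0 1 = cball (0::'a) r"
    using cball_scale [of r 0 1] assms by (cases "r = 0") (auto simp: image_constant_conv)
  then show ?thesis
    unfolding ball_thickening_def set_plus_def
    by (auto simp: dist_norm norm_minus_commute)
       (metis add_diff_cancel_left' diff_add_cancel add.commute mem_cball_0 dist_norm norm_minus_commute)
qed

text \<open>This semigroup law makes the thickening of \<open>A\<close> by any \<open>t \<ge> 1\<close> a 1-parallel set, and identifies
  the difference quotients of its surface area with those of \<open>r \<mapsto> \<gamma> A\<^sub>r\<close> at \<open>t\<close>. It rests on
  the fact that a segment of length at most \<open>r + s\<close> splits into pieces of length at most \<open>r\<close> and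
  \<open>s\<close>.\<close>

lemma ball_thickening_ball_thickening:
  fixes A :: "'a::euclidean_space set"
  assumes "0 \<le> r" "0 \<le> s"
  shows "ball_thickening s (ball_thickening r A) = ball_thickening (r + s) A"
proof -
  have "cball a (r + s) = (\<Union>b\<in>cball a r. cball b s)" for a :: 'a
  proof (intro equalityI subsetI)
    fix x
    assume "x \<in> cball a (r + s)"
    then have x: "norm (x - a) \<le> r + s"
      by (simp add: dist_norm norm_minus_commute)
    define b where "b = a + (r / (r + s)) *\<^sub>R (x - a)"
    have "b \<in> cball a r \<and> x \<in> cball b s"
    proof (cases "r + s = 0")
      case True
      then show ?thesis
        using x assms by (auto simp: b_def)
    next
      case False
      with assms have "0 < r + s"
        by simp
      have "x - b = (1 - r / (r + s)) *\<^sub>R (x - a)"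
        unfolding b_def scaleR_diff_left by simp
      also have "1 - r / (r + s) = s / (r + s)"
        using False by (simp add: field_simps)
      finally have "norm (x - b) = s / (r + s) * norm (x - a)"
        using assms by simp
      moreover have "norm (b - a) = r / (r + s) * norm (x - a)"
        using assms by (simp add: b_def)
      ultimately show ?thesis
        using mult_left_mono [OF x, of "s / (r + s)"] mult_left_mono [OF x, of "r / (r + s)"]
          assms False
        by (simp add: dist_norm norm_minus_commute [of b x] norm_minus_commute [of a b])
    qed
    then show "x \<in> (\<Union>b\<in>cball a r. cball b s)"
      by blast
  next
    fix x
    assume "x \<in> (\<Union>b\<in>cball a r. cball b s)"
    then obtain b where "dist a b \<le> r" "dist b x \<le> s"
      by auto
    then show "x \<in> cball a (r + s)"
      using dist_triangle [of a x b] by simp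
  qed
  then show ?thesis
    using assms by (simp add: ball_thickening_eq_UN UN_UN_flatten)
qed

lemma compact_ball_thickening:
  fixes A :: "'a::euclidean_space set"
  assumes "finite A" "0 \<le> r"
  shows "compact (ball_thickening r A)"
  using assms by (auto simp: ball_thickening_eq_UN intro!: compact_UN)

lemma ball_thickening_mono:
  fixes A :: "'a::euclidean_space set"
  assumes "0 \<le> r" "r \<le> s"
  shows "ball_thickening r A \<subseteq> ball_thickening s A"
  using assms by (simp add: ball_thickening_eq_UN) (intro UN_mono subset_cball; simp)

text \<open>The set gained between radii \<open>r\<close> and \<open>s\<close> lies in the union of the spherical shells around the
  points of \<open>A\<close>.\<close>

lemma gaussian_thickening_increment_le:
  fixes A :: "'a::euclidean_space set"
  assumes "finite A" "0 \<le> r" "r \<le> s"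
  shows "measure std_gaussian (ball_thickening s A) - measure std_gaussian (ball_thickening r A)
    \<le> card A * (unit_ball_vol DIM('a) * (s ^ DIM('a) - r ^ DIM('a)))"
proof -
  interpret prob_space "std_gaussian :: 'a measure"
    by (rule prob_space_std_gaussian)
  have [simp]: "ball_thickening t A \<in> sets lebesgue" if "0 \<le> t" for t
    using compact_ball_thickening [OF assms(1) that] by (simp add: borel_compact)
  have shell: "measure std_gaussian (cball a s - cball a r)
      \<le> unit_ball_vol DIM('a) * (s ^ DIM('a) - r ^ DIM('a))" for a :: 'a
  proof -
    have "emeasure std_gaussian (cball a s - cball a r) \<le> emeasure lborel (cball a s - cball a r)"
      using std_gaussian_le_lebesgue [of "cball a s - cball a r"]
      by (simp add: emeasure_completion)
    also have "\<dots> = ennreal (unit_ball_vol DIM('a) * (s ^ DIM('a) - r ^ DIM('a)))"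
      using assms
      by (subst emeasure_Diff)
         (auto simp: emeasure_cball ennreal_minus right_diff_distrib subset_cball)
    finally show ?thesis
      using assms by (simp add: emeasure_eq_measure power_mono)
  qed
  have "measure std_gaussian (ball_thickening s A) - measure std_gaussian (ball_thickening r A)
    = measure std_gaussian (ball_thickening s A - ball_thickening r A)"
    using assms ball_thickening_mono [of r s A] by (subst finite_measure_Diff) auto
  also have "\<dots> \<le> measure std_gaussian (\<Union>a\<in>A. cball a s - cball a r)"
    using assms by (intro finite_measure_mono) (auto simp: ball_thickening_eq_UN)
  also have "\<dots> \<le> (\<Sum>a\<in>A. measure std_gaussian (cball a s - cball a r))"
    using assms by (intro finite_measure_subadditive_finite) auto
  also have "\<dots> \<le> (\<Sum>a\<in>A. unit_ball_vol DIM('a) * (s ^ DIM('a) - r ^ DIM('a)))"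
    by (intro sum_mono shell)
  finally show ?thesis
    by simp
qed

lemma continuous_on_gaussian_thickening:
  fixes A :: "'a::euclidean_space set"
  assumes "finite A"
  shows "continuous_on {0..} (\<lambda>r. measure std_gaussian (ball_thickening r A))" (is "continuous_on _ ?f")
proof (rule continuous_onI)
  fix r e :: real
  assume r: "r \<in> {0..}" and "0 < e"
  interpret prob_space "std_gaussian :: 'a measure"
    by (rule prob_space_std_gaussian)
  let ?g = "\<lambda>t::real. card A * (unit_ball_vol DIM('a) * t ^ DIM('a))"
  have "continuous_on {0..} ?g"
    by (intro continuous_intros)
  then obtain d where d: "d > 0" "\<And>s. s \<in> {0..} \<Longrightarrow> dist s r < d \<Longrightarrow> dist (?g s) (?g r) < e"
    using r \<open>0 < e\<close> unfolding continuous_on_iff by meson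
  have "?f s \<le> ?f t \<and> ?f t - ?f s \<le> ?g t - ?g s" if "0 \<le> s" "s \<le> t" for s t
    using that gaussian_thickening_increment_le [OF assms that]
      compact_ball_thickening [OF assms, of t] ball_thickening_mono [OF that]
    by (auto simp: borel_compact algebra_simps intro!: finite_measure_mono)
  note increment = this
  have "dist (?f s) (?f r) \<le> dist (?g s) (?g r)" if "0 \<le> s" for s
  proof (cases "s \<le> r")
    case True
    with increment [of s r] that show ?thesis
      by (simp add: dist_real_def)
  next
    case False
    with increment [of r s] r show ?thesis
      by (simp add: dist_real_def)
  qed
  then show "\<exists>d>0. \<forall>s\<in>{0..}. dist s r < d \<longrightarrow> dist (?f s) (?f r) \<le> e"
    using d by (intro exI [of _ d]) (fastforce intro: order_trans less_imp_le)
qed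

section \<open>A mean value inequality for the upper right derivative\<close>

text \<open>If the upper right derivative were below \<open>c\<close> everywhere, the largest point up to which \<open>f\<close>
  satisfies \<open>f t - f a \<le> c * (t - a)\<close> could be pushed further to the right, unless it is \<open>b\<close>
  itself.\<close>

lemma upper_right_derivative_mean_value:
  fixes f :: "real \<Rightarrow> real"
  assumes cont: "continuous_on {a..b} f" and "a < b" and less: "c * (b - a) < f b - f a"
  obtains t where "a \<le> t" "t < b"
    "Limsup (at_right 0) (\<lambda>\<epsilon>. ereal ((f (t + \<epsilon>) - f t) / \<epsilon>)) \<ge> ereal c"
proof (rule ccontr)
  note found = that
  assume "\<not> thesis"
  then have small: "Limsup (at_right 0) (\<lambda>\<epsilon>. ereal ((f (t + \<epsilon>) - f t) / \<epsilon>)) < ereal c"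
    if "a \<le> t" "t < b" for t
    using found that \<open>\<not> thesis\<close> by (meson not_le)
  define S where "S = {t \<in> {a..b}. f t - c * t \<le> f a - c * a}"
  define t where "t = Sup S"
  have "closed S"
  proof -
    have "continuous_on {a..b} (\<lambda>t. f t - c * t)"
      by (intro continuous_intros cont)
    then have "closed ({a..b} \<inter> (\<lambda>t. f t - c * t) -` {..f a - c * a})"
      by (intro continuous_closed_preimage) auto
    also have "{a..b} \<inter> (\<lambda>t. f t - c * t) -` {..f a - c * a} = S"
      by (auto simp: S_def)
    finally show ?thesis .
  qed
  moreover have "a \<in> S" "bdd_above S"
    using \<open>a < b\<close> unfolding S_def by (auto intro!: bdd_aboveI [of _ b])
  ultimately have "t \<in> S"
    unfolding t_def by (intro closed_contains_Sup) auto
  have "t \<noteq> b"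
    using less \<open>t \<in> S\<close> unfolding S_def by (auto simp: algebra_simps)
  with \<open>t \<in> S\<close> have t: "a \<le> t" "t < b" "f t - c * t \<le> f a - c * a"
    unfolding S_def by auto
  have "\<forall>\<^sub>F \<epsilon> in at_right 0. (f (t + \<epsilon>) - f t) / \<epsilon> < c"
    using Limsup_lessD [OF small [OF t(1,2)]] by simp
  moreover have "\<forall>\<^sub>F \<epsilon> in at_right 0. \<epsilon> \<in> {0<..<b - t}"
    using t by (intro eventually_at_right_real) simp
  ultimately have "\<forall>\<^sub>F \<epsilon> in at_right 0. t + \<epsilon> \<in> S \<and> 0 < \<epsilon>"
    by eventually_elim (use t in \<open>auto simp: S_def field_simps\<close>)
  then obtain \<epsilon> where "t + \<epsilon> \<in> S" "0 < \<epsilon>"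
    using eventually_happens' [OF trivial_limit_at_right_real] by blast
  then show False
    using cSup_upper [OF \<open>t + \<epsilon> \<in> S\<close> \<open>bdd_above S\<close>] by (simp add: t_def)
qed

section \<open>Random centres\<close>

text \<open>The bound on \<open>\<theta>\<close> is a lower bound for the expected measure of the shell between radii \<open>r\<close> and
  \<open>s\<close> when \<open>A\<close> consists of \<open>N\<close> independent uniform points of \<open>cball 0 m\<close>. The expectation is computed
  by integrating over the points of space last: each \<open>x\<close> in \<open>cball 0 (m - s)\<close> has its balls of radius
  \<open>r\<close> and \<open>s\<close> inside \<open>cball 0 m\<close>, so it avoids all the balls of radius \<open>t \<le> s\<close> with
  probability exactly \<open>(1 - t ^ d / N) ^ N\<close>.\<close>

lemma exists_large_shell:
  fixes m N :: nat and r s \<theta> :: real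
  assumes N: "N = m ^ DIM('a::euclidean_space)" and "0 < m" and rs: "0 \<le> r" "r \<le> s"
    and \<theta>: "\<theta> < measure (std_gaussian :: 'a::euclidean_space measure) (cball 0 (m - s)) *
      ((1 - r ^ DIM('a) / N) ^ N - (1 - s ^ DIM('a) / N) ^ N)"
  obtains A :: "'a::euclidean_space set" where "finite A"
    "\<theta> < measure std_gaussian (ball_thickening s A) - measure std_gaussian (ball_thickening r A)"
proof -
  define G where "G = (std_gaussian :: 'a measure)"
  define U where "U = uniform_measure lborel (cball (0::'a) m)"
  define P where "P = (\<Pi>\<^sub>M i\<in>{..<N}. U)"
  interpret G: prob_space G
    unfolding G_def by (rule prob_space_std_gaussian)
  have ball_pos: "emeasure lborel (cball (0::'a) m) = ennreal (unit_ball_vol DIM('a) * real N)"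
    by (simp add: emeasure_cball N)
  have "0 < N"
    using \<open>0 < m\<close> by (simp add: N)
  then have "prob_space U"
    unfolding U_def using ball_pos
    by (intro prob_space_uniform_measure) (auto simp: ennreal_eq_0_iff unit_ball_vol_pos not_le)
  then interpret U: prob_space U .
  interpret P: finite_product_prob_space "\<lambda>_. U" "{..<N}"
    by unfold_locales auto
  interpret PP: prob_space P
    unfolding P_def by (intro prob_space_PiM U.prob_space_axioms)
  interpret GP: pair_prob_space G P ..
  have [measurable_cong, simp]: "sets U = sets borel"
    by (simp add: U_def)
  have [simp]: "space U = UNIV" "space G = UNIV"
    by (simp_all add: U_def G_def)
  have fst: "fst \<in> borel_measurable (G \<Otimes>\<^sub>M P)"
    by (rule measurable_compose [OF measurable_fst])
       (simp add: G_def std_gaussian_def measurable_completion)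
  have snd: "(\<lambda>z. snd z i) \<in> borel_measurable (G \<Otimes>\<^sub>M P)" if "i < N" for i
  proof -
    have "(\<lambda>z. snd z i) \<in> measurable (G \<Otimes>\<^sub>M P) U"
      unfolding P_def using that
      by (intro measurable_compose [OF measurable_snd measurable_component_singleton]) auto
    then show ?thesis
      by (simp cong: measurable_cong_sets)
  qed
  \<comment> \<open>\<open>V t x\<close> is the event that no centre is within \<open>t\<close> of \<open>x\<close>; the sections of \<open>D\<close> at fixed centres
    are the shells, those at fixed \<open>x\<close> in \<open>cball 0 (m - s)\<close> have probability \<open>q\<close>.\<close>
  define V where "V t x = (\<Pi>\<^sub>E i\<in>{..<N}. - cball x t)" for t and x :: 'a
  define D where "D = {z \<in> space (G \<Otimes>\<^sub>M P). snd z \<in> V r (fst z) - V s (fst z)}"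
  have V_iff: "\<omega> \<in> V t x \<longleftrightarrow> (\<forall>i\<in>{..<N}. t < dist x (\<omega> i))" if "\<omega> \<in> space P" for \<omega> t x
    using that by (auto simp: V_def P_def space_PiM PiE_iff not_le)
  have V_sets: "V t x \<in> sets P" for t x
    unfolding V_def P_def by (intro sets_PiM_I_finite) auto
  have V_anti: "V s x \<subseteq> V r x" for x
    unfolding V_def using rs by (intro PiE_mono) (auto intro: order_trans)
  have D: "D \<in> sets (G \<Otimes>\<^sub>M P)"
  proof -
    have [measurable]: "(\<lambda>z. dist (fst z) (snd z i)) \<in> borel_measurable (G \<Otimes>\<^sub>M P)" if "i \<in> {..<N}" for i
      using that by (intro borel_measurable_dist fst snd) auto
    have "D = {z \<in> space (G \<Otimes>\<^sub>M P). (\<forall>i\<in>{..<N}. r < dist (fst z) (snd z i)) \<and>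
        \<not> (\<forall>i\<in>{..<N}. s < dist (fst z) (snd z i))}"
      unfolding D_def by (auto simp: V_iff space_pair_measure)
    also have "\<dots> \<in> sets (G \<Otimes>\<^sub>M P)"
      by measurable
    finally show ?thesis .
  qed
  have U_cball: "measure U (cball x t) = t ^ DIM('a) / N"
    if "x \<in> cball 0 (m - s)" "0 \<le> t" "t \<le> s" for x t
  proof -
    have "cball x t \<subseteq> cball 0 m"
      using that norm_triangle_ineq [of x] by (auto simp: cball_subset_cball_iff dist_norm)
    then have "cball 0 m \<inter> cball x t = cball x t"
      by blast
    then have "measure U (cball x t) = measure lborel (cball x t) / measure lborel (cball (0::'a) m)"
      unfolding U_def using ball_pos \<open>0 < N\<close>
      by (subst measure_uniform_measure) (auto simp: ennreal_eq_0_iff unit_ball_vol_pos not_le)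
    also have "\<dots> = t ^ DIM('a) / N"
      using that less_imp_neq [OF unit_ball_vol_pos [of "real DIM('a)"]]
      by (simp add: content_cball N)
    finally show ?thesis .
  qed
  define q where "q = (1 - r ^ DIM('a) / N) ^ N - (1 - s ^ DIM('a) / N) ^ N"
  have q: "emeasure P (Pair x -` D) = ennreal q" if x: "x \<in> cball 0 (m - s)" for x
  proof -
    have V: "measure P (V t x) = (1 - t ^ DIM('a) / N) ^ N" if t: "0 \<le> t" "t \<le> s" for t
    proof -
      have "measure U (- cball x t) = 1 - t ^ DIM('a) / N"
        using U.prob_compl [of "cball x t"] U_cball [OF x t] by (simp add: Compl_eq_Diff_UNIV)
      then show ?thesis
        unfolding V_def P_def by (subst P.finite_measure_PiM_emb) auto
    qed
    have "Pair x -` D = V r x - V s x"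
      unfolding D_def using sets.sets_into_space [OF V_sets] by (auto simp: space_pair_measure)
    then have "measure P (Pair x -` D) = q"
      using V_sets V_anti rs by (simp add: PP.finite_measure_Diff V q_def)
    then show ?thesis
      by (simp add: PP.emeasure_eq_measure)
  qed
  define shell where "shell \<omega> = ball_thickening s (\<omega> ` {..<N}) - ball_thickening r (\<omega> ` {..<N})"
    for \<omega> :: "nat \<Rightarrow> 'a"
  have slice: "(\<lambda>x. (x, \<omega>)) -` D = shell \<omega>" if "\<omega> \<in> space P" for \<omega>
  proof (intro set_eqI)
    fix x
    have "x \<in> shell \<omega> \<longleftrightarrow> (\<forall>i\<in>{..<N}. r < dist x (\<omega> i)) \<and> \<not> (\<forall>i\<in>{..<N}. s < dist x (\<omega> i))"
      using rs by (simp add: shell_def ball_thickening_eq_UN dist_commute [of x] flip: not_le) blast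
    also have "\<dots> \<longleftrightarrow> x \<in> (\<lambda>x. (x, \<omega>)) -` D"
      using that by (simp add: D_def V_iff space_pair_measure)
    finally show "x \<in> (\<lambda>x. (x, \<omega>)) -` D \<longleftrightarrow> x \<in> shell \<omega>"
      by (rule sym)
  qed
  have "\<exists>\<omega>\<in>space P. \<theta> < measure G (shell \<omega>)"
  proof (rule ccontr)
    assume "\<not> ?thesis"
    then have le: "measure G (shell \<omega>) \<le> \<theta>" if "\<omega> \<in> space P" for \<omega>
      using that by force
    then have "0 \<le> \<theta>"
      using PP.not_empty order_trans [OF measure_nonneg] by blast
    have "ennreal (q * measure G (cball 0 (m - s))) = (\<integral>\<^sup>+x. ennreal q * indicator (cball 0 (m - s)) x \<partial>G)"
      by (subst nn_integral_cmult_indicator)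
         (auto simp: G_def G.emeasure_eq_measure [unfolded G_def] ennreal_mult'')
    also have "\<dots> \<le> (\<integral>\<^sup>+x. emeasure P (Pair x -` D) \<partial>G)"
      by (intro nn_integral_mono) (auto simp: indicator_def q)
    also have "\<dots> = emeasure (G \<Otimes>\<^sub>M P) D"
      by (rule PP.emeasure_pair_measure_alt [OF D, symmetric])
    also have "\<dots> = (\<integral>\<^sup>+\<omega>. emeasure G ((\<lambda>x. (x, \<omega>)) -` D) \<partial>P)"
      by (rule GP.emeasure_pair_measure_alt2 [OF D])
    also have "\<dots> \<le> (\<integral>\<^sup>+\<omega>. ennreal \<theta> \<partial>P)"
      by (intro nn_integral_mono) (simp add: slice G.emeasure_eq_measure le ennreal_leI)
    also have "\<dots> = ennreal \<theta>"
      by (simp add: PP.emeasure_space_1)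
    finally show False
      using \<theta> \<open>0 \<le> \<theta>\<close> by (simp add: q_def G_def mult.commute)
  qed
  then obtain \<omega> where "\<theta> < measure G (shell \<omega>)"
    by blast
  also have "measure G (shell \<omega>) = measure G (ball_thickening s (\<omega> ` {..<N}))
      - measure G (ball_thickening r (\<omega> ` {..<N}))"
    unfolding shell_def using rs ball_thickening_mono [of r s "\<omega> ` {..<N}"]
    by (intro G.finite_measure_Diff)
       (auto simp: G_def borel_compact compact_ball_thickening)
  finally show thesis
    by (intro that) (auto simp: G_def)
qed

text \<open>Passage to the limit of large \<open>m\<close>, where \<open>(1 - t / m ^ d) ^ (m ^ d)\<close> tends to
  \<open>exp (- t)\<close>.\<close>

lemma exists_fast_growing_thickening:
  fixes s \<theta> :: real
  assumes s: "1 \<le> s" and \<theta>: "\<theta> < exp (- 1) - exp (- (s ^ DIM('a::euclidean_space)))"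
  obtains A :: "'a::euclidean_space set" where "finite A"
    "\<theta> < measure std_gaussian (ball_thickening s A) - measure std_gaussian (ball_thickening 1 A)"
proof -
  interpret prob_space "std_gaussian :: 'a measure"
    by (rule prob_space_std_gaussian)
  define N where "N m = m ^ DIM('a)" for m :: nat
  have N: "filterlim N at_top sequentially"
    unfolding N_def by (intro filterlim_at_top_mono [OF filterlim_ident]) (auto simp: self_le_power eventually_sequentially intro!: exI [of _ 1])
  have 1: "(\<lambda>m. (1 - t / N m) ^ N m) \<longlonglongrightarrow> exp (- t)" for t
    using filterlim_compose [OF tendsto_exp_limit_sequentially [of "- t"] N] by simp
  have union: "(\<Union>m. cball (0::'a) (real m - s)) = UNIV"
  proof -
    have "\<exists>m. norm x \<le> real m - s" for x :: 'a
      using real_arch_simple [of "norm x + s"] by (auto simp: le_diff_eq)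
    then show ?thesis
      by auto
  qed
  have "(\<lambda>m. measure std_gaussian (cball (0::'a) (real m - s)))
      \<longlonglongrightarrow> measure std_gaussian (\<Union>m. cball (0::'a) (real m - s))"
    by (intro finite_Lim_measure_incseq) (auto simp: incseq_def)
  then have 2: "(\<lambda>m. measure std_gaussian (cball (0::'a) (real m - s))) \<longlonglongrightarrow> 1"
    using prob_space by (simp add: union)
  have "(\<lambda>m. measure std_gaussian (cball (0::'a) (real m - s)) *
      ((1 - 1 ^ DIM('a) / N m) ^ N m - (1 - s ^ DIM('a) / N m) ^ N m))
      \<longlonglongrightarrow> 1 * (exp (- (1 ^ DIM('a))) - exp (- (s ^ DIM('a))))"
    by (intro tendsto_intros 1 2)
  then have "\<forall>\<^sub>F m in sequentially. \<theta> < measure std_gaussian (cball (0::'a) (real m - s)) *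
      ((1 - 1 ^ DIM('a) / N m) ^ N m - (1 - s ^ DIM('a) / N m) ^ N m)"
    using \<theta> by (intro order_tendstoD) auto
  then have "\<forall>\<^sub>F m in sequentially. 0 < m \<and> \<theta> < measure std_gaussian (cball (0::'a) (real m - s)) *
      ((1 - 1 ^ DIM('a) / N m) ^ N m - (1 - s ^ DIM('a) / N m) ^ N m)"
    using eventually_gt_at_top [of 0] by eventually_elim auto
  then obtain m where "0 < m" "\<theta> < measure std_gaussian (cball (0::'a) (real m - s)) *
      ((1 - 1 ^ DIM('a) / N m) ^ N m - (1 - s ^ DIM('a) / N m) ^ N m)"
    using eventually_happens' [OF sequentially_bot] by blast
  then show thesis
    using exists_large_shell [of "N m" m 1 s \<theta>] s that by (auto simp: N_def)
qed

section \<open>Parallel sets of large Gaussian surface area\<close>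

text \<open>The constant \<open>d / e\<close> is the derivative at \<open>h = 0\<close> of the increment
  \<open>exp (-1) - exp (-((1 + h) ^ d))\<close>, so some small \<open>h\<close> has mean slope above \<open>c\<close>.\<close>

lemma exists_parallel_set_surface_ge:
  assumes c: "c < DIM('a::euclidean_space) * exp (- 1)"
  obtains S :: "'a::euclidean_space set" where "is_parallel_set 1 S" "upper_gaussian_surface_area S \<ge> ereal c"
proof -
  have "((\<lambda>t. exp (- 1) - exp (- (t ^ DIM('a)))) has_real_derivative DIM('a) * exp (- 1)) (at 1)"
    by (auto intro!: derivative_eq_intros)
  then have "((\<lambda>h. (exp (- 1) - exp (- ((1 + h) ^ DIM('a)))) / h) \<longlongrightarrow> DIM('a) * exp (- 1)) (at (0::real))"
    by (simp add: DERIV_def)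
  then have "\<forall>\<^sub>F h::real in at_right 0. c < (exp (- 1) - exp (- ((1 + h) ^ DIM('a)))) / h"
    using c order_tendstoD(1) [of _ _ "at_right (0::real)" c]
    unfolding filterlim_at_split by blast
  then have "\<forall>\<^sub>F h::real in at_right 0. 0 < h \<and> c * h < exp (- 1) - exp (- ((1 + h) ^ DIM('a)))"
    using eventually_at_right_less by eventually_elim (simp add: field_simps)
  then obtain h :: real where h: "0 < h" "c * h < exp (- 1) - exp (- ((1 + h) ^ DIM('a)))"
    using eventually_happens' [OF trivial_limit_at_right_real] by blast
  obtain A :: "'a set" where A: "finite A"
    "c * h < measure std_gaussian (ball_thickening (1 + h) A) - measure std_gaussian (ball_thickening 1 A)"
    using exists_fast_growing_thickening [of "1 + h" "c * h"] h by auto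
  define f where "f r = measure std_gaussian (ball_thickening r A)" for r
  have "continuous_on {1..1 + h} f"
    unfolding f_def
    by (rule continuous_on_subset [OF continuous_on_gaussian_thickening [OF A(1)]]) auto
  then obtain t where t: "1 \<le> t"
    "Limsup (at_right 0) (\<lambda>\<epsilon>. ereal ((f (t + \<epsilon>) - f t) / \<epsilon>)) \<ge> ereal c"
    using upper_right_derivative_mean_value [of 1 "1 + h" f c] h A(2)
    by (auto simp: f_def [of "1 + h"] f_def [of 1])
  let ?S = "ball_thickening t A"
  have "upper_gaussian_surface_area ?S = Limsup (at_right 0) (\<lambda>\<epsilon>. ereal ((f (t + \<epsilon>) - f t) / \<epsilon>))"
    unfolding upper_gaussian_surface_area_def f_def using t(1)
    by (intro Limsup_eq eventually_mono [OF eventually_at_right_less])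
       (simp add: ball_thickening_ball_thickening)
  with t have "upper_gaussian_surface_area ?S \<ge> ereal c"
    by simp
  moreover have "is_parallel_set 1 ?S"
    unfolding is_parallel_set_def
    using t(1) A(1) ball_thickening_ball_thickening [of "t - 1" 1 A]
    by (auto intro!: bexI [of _ "ball_thickening (t - 1) A"] borel_compact compact_ball_thickening)
  ultimately show thesis
    by (rule that [rotated])
qed

theorem mainTheorem3:
  shows "\<exists>S :: (real ^ 'n) set. is_parallel_set 1 S \<and>
    upper_gaussian_surface_area S \<ge> ereal (0.28 * real CARD('n) powr (1/4))"
proof -
  have "1 \<le> real CARD('n)"
    by (simp add: Suc_le_eq)
  then have "real CARD('n) powr (1/4) \<le> real CARD('n) powr 1"
    by (intro powr_mono) auto
  moreover have "0.28 < exp (- 1 :: real)"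
    using e_less_272 by (simp add: exp_minus field_simps)
  ultimately have "0.28 * real CARD('n) powr (1/4) < exp (- 1) * real CARD('n)"
    using \<open>1 \<le> real CARD('n)\<close> by (intro mult_less_le_imp_less) auto
  then have "0.28 * real CARD('n) powr (1/4) < DIM(real ^ 'n) * exp (- 1)"
    by (simp add: mult.commute)
  then show ?thesis
    by (rule exists_parallel_set_surface_ge) blast
qed

end
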